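(* Let $\mathcal{S}=\{s_1<s_2<\cdots\}\subset\mathbb{N}$ be an infinite set with counting function $S(x)=|\mathcal{S}\cap[1,x]|$, and let $f(x)=x/S(x)$. Assume: (S1) $f(x)\to\infty$ as $x\to\infty$. (S2) For every fixed $h$, the number of $s_k\leq x$ satisfying $s_{k+2}-s_k\leq h$ is $o_h(S(x)/\log f(x))$ as $x\to\infty$. Let $(\delta_n)_{n\geq 1}$ be a sequence of positive real numbers such that: (D1) $\delta_n\geq 2$ for all but $o(x)$ integers $n\leq x$, as $x\to\infty$. (D2) There exists an integer $\ell\ge 1$ such that $\sum_{s_k\leq x}\prod_{i=0}^{\ell-1}\delta_{k+i}^{-1}=o(S(x)/\log f(x))$ as $x\to\infty$. (D3) $1\leq\delta_n\leq (s_{n+1}-s_{n-1})/2$ for all $n\geq 2$. Let $(\varepsilon_n)_{n\geq 1}$ be a sequence of independent random integers such that: (E1) $-(s_n-s_{n-1})/2<\varepsilon_n\leq (s_{n+1}-s_n)/2$ for all $n\geq 2$, and $-s_1\leq \varepsilon_1\leq (s_2-s_1)/2$. (E2) For every $n\geq 1$ and every $k\in\mathbb{Z}$, $\Pr(\varepsilon_n=k)\leq\delta_n^{-1}$. Let $c_n=s_n+\varepsilon_n$ and let $\mathcal{C}=\{c_n : n\geq 1\}\subset\mathbb{N}$. Then the random set $\mathcal{C}$ is almost surely totally primitive.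
   Context: Here $\mathbb{N}=\{0,1,2,\ldots\}$. For sets of integers, $\mathcal{A}+\mathcal{B}=\{a+b : (a,b)\in\mathcal{A}\times\mathcal{B}\}$, and $\mathcal{A}\sim\mathcal{B}$ means that the symmetric difference $\mathcal{A}\Delta\mathcal{B}$ is finite. A set $\mathcal{C}\subset\mathbb{N}$ is asymptotically additively decomposable if there exist sets $\mathcal{A},\mathcal{B}\subset\mathbb{N}$ of cardinality at least two each such that $\mathcal{C}\sim\mathcal{A}+\mathcal{B}$. A set which is not asymptotically additively decomposable is called totally primitive. The notation $o_h$ means that the rate of decay may depend on $h$. *)

theory Defs
  imports "HOL-Probability.Probability" "HOL-Library.Landau_Symbols" "HOL-Library.Set_Algebras"
begin

definition counting :: "nat set \<Rightarrow> real \<Rightarrow> real" where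
  "counting S x = real (card {n \<in> S. 1 \<le> n \<and> real n \<le> x})"

definition asymp_eq_set :: "int set \<Rightarrow> int set \<Rightarrow> bool" where
  "asymp_eq_set A B \<longleftrightarrow> finite (sym_diff A B)"

text \<open>\<^const>\<open>card\<close> of an infinite set is 0, so ``at least two elements'' needs the disjunction.
  The sum of sets is the elementwise one from \<open>HOL-Library.Set_Algebras\<close>.\<close>

definition asymp_decomposable :: "int set \<Rightarrow> bool" where
  "asymp_decomposable C \<longleftrightarrow>
     (\<exists>A B. A \<subseteq> \<nat> \<and> B \<subseteq> \<nat> \<and> (infinite A \<or> card A \<ge> 2) \<and> (infinite B \<or> card B \<ge> 2) \<and>
            asymp_eq_set C (A + B))"

text \<open>The notion is only meant for sets of natural numbers, hence the first conjunct.\<close>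

definition totally_primitive :: "int set \<Rightarrow> bool" where
  "totally_primitive C \<longleftrightarrow> C \<subseteq> \<nat> \<and> \<not> asymp_decomposable C"

end

theory Submission imports Defs begin

text \<open>The perturbed terms \<open>c n = s n + \<epsilon> n\<close> lie in disjoint cells, so they increase with \<open>n\<close>. Suppose that their
set \<open>C\<close> agrees with \<open>A + B\<close> from some point on; two cases are excluded almost surely.

If one summand, say \<open>A\<close>, is finite, it has at least two elements, and every large element \<open>a + b\<close> of \<open>C\<close> has another one, \<open>a' + b\<close>, within
a fixed distance \<open>H\<close>, hence a neighbour within \<open>H\<close>
(\<open>finite_summand_gives_close_pair\<close>). For a given \<open>j\<close> the probability that \<open>c j\<close> has such a
neighbour is at most \<open>2 * (2 * H + 1) / \<delta> j\<close>, and \<open>\<delta>\<close> is unbounded as a consequence of the condition on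
the products of the \<open>1 / \<delta> k\<close> (\<open>unbounded_if_products_negligible\<close>).

If both summands are infinite, both contain four elements below some \<open>H\<close>. Then every \<open>b \<in> B\<close> produces four
elements of \<open>C\<close> in a window of length \<open>H\<close>, which forces \<open>s (k + 2) - s k \<le> 2 * H\<close> for some \<open>k\<close> that
determines \<open>b\<close>. Such \<open>k\<close> are rare, and so both summands have \<open>o(S(x) / log f(x))\<close>
elements up to \<open>x\<close>, with a bound that depends on \<open>H\<close> only (\<open>other_summand_sparse\<close>). There are
only \<open>exp (o(S(x)))\<close> sets of that size in \<open>{0..x}\<close> (\<open>card_small_subsets_le\<close>), so the part of \<open>C\<close> in
\<open>{0..x}\<close> is one of \<open>exp (o(S(x)))\<close> explicit sets. Each of these prescribes the values of nearly all of the
independent \<open>\<epsilon> n\<close> with \<open>s n \<le> x\<close>, most of which take any given value with probability at most \<open>1 / 2\<close>; so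
each of them occurs with probability at most \<open>2 ^ (- S(x) / 2)\<close> for large \<open>x\<close>. The union bound
(\<open>prob_sparse_sumset_le\<close>, \<open>union_bound_le_exp\<close>) tends to \<open>0\<close> as \<open>x \<rightarrow> \<infinity>\<close>.\<close>

section \<open>Sequences interlaced with the midpoints of another sequence\<close>

text \<open>From the second term on, \<open>c n\<close> stays in the half-open cell between the two midpoints around \<open>s n\<close>; the
first cell extends down to \<open>0\<close>. The cells are disjoint, so \<open>c\<close> keeps the order of \<open>s\<close> and lags
behind or runs ahead of it by less than one step. The inequalities are doubled in order to stay in the
integers.\<close>

locale interlaced =
  fixes s :: "nat \<Rightarrow> nat" and c :: "nat \<Rightarrow> int"
  assumes s_mono: "strict_mono_on {1..} s"
    and lower: "\<And>n. n \<ge> 1 \<Longrightarrow> int (s n) + int (s (Suc n)) < 2 * c (Suc n)"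
    and upper: "\<And>n. n \<ge> 1 \<Longrightarrow> 2 * c n \<le> int (s n) + int (s (Suc n))"
    and first: "0 \<le> c 1"

text \<open>The indices start at \<open>1\<close>, and \<open>s 1\<close> may be \<open>0\<close>; hence the shift by one.\<close>

lemma enumeration_ge:
  fixes s :: "nat \<Rightarrow> nat"
  assumes "strict_mono_on {1..} s" "1 \<le> n"
  shows "n \<le> Suc (s n)"
  using assms(2)
proof (induction n rule: dec_induct)
  case (step n)
  have "s n < s (Suc n)"
    using assms(1) step.hyps by (intro strict_mono_onD[of "{1..}" s]) auto
  with step.IH show ?case by simp
qed simp

lemma finite_enumeration_le:
  fixes s :: "nat \<Rightarrow> nat"
  assumes "strict_mono_on {1..} s"
  shows "finite {k. 1 \<le> k \<and> real (s k) \<le> x}"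
proof (rule finite_subset)
  show "{k. 1 \<le> k \<and> real (s k) \<le> x} \<subseteq> {..Suc (nat \<lfloor>x\<rfloor>)}"
  proof
    fix k assume "k \<in> {k. 1 \<le> k \<and> real (s k) \<le> x}"
    then show "k \<in> {..Suc (nat \<lfloor>x\<rfloor>)}"
      using enumeration_ge[OF assms, of k] le_nat_floor[of "s k" x] by auto
  qed
qed simp

context interlaced begin

lemma s_less: "1 \<le> n \<Longrightarrow> s n < s (Suc n)"
  using s_mono by (intro strict_mono_onD[of "{1..}" s]) auto

lemma s_less_c: "1 \<le> n \<Longrightarrow> int (s n) < c (Suc n)"
  using lower[of n] s_less[of n] by linarith

lemma c_less_s: "1 \<le> n \<Longrightarrow> c n < int (s (Suc n))"
  using upper[of n] s_less[of n] by linarith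

lemma c_less: "m < n \<Longrightarrow> 1 \<le> m \<Longrightarrow> c m < c n"
proof (induction rule: less_Suc_induct)
  case (1 i)
  then show ?case using upper[of i] lower[of i] by linarith
next
  case (2 i j k)
  then show ?case by linarith
qed

lemma c_less_iff: "1 \<le> m \<Longrightarrow> 1 \<le> n \<Longrightarrow> c m < c n \<longleftrightarrow> m < n"
  using c_less[of m n] c_less[of n m] by (metis linorder_neqE_nat less_asym)

lemma c_le_iff: "1 \<le> m \<Longrightarrow> 1 \<le> n \<Longrightarrow> c m \<le> c n \<longleftrightarrow> m \<le> n"
  using c_less_iff[of n m] by (simp add: not_less[symmetric])

lemma inj_c: "inj_on c {1..}"
proof (rule inj_onI)
  fix m n assume "m \<in> {1..}" "n \<in> {1..}" "c m = c n"
  then show "m = n" using c_le_iff[of m n] c_le_iff[of n m] by simp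
qed

lemma c_nonneg: "1 \<le> n \<Longrightarrow> 0 \<le> c n"
  using c_le_iff[of 1 n] first by linarith

text \<open>The \<open>i\<close>-th term can be read off from any truncation of the range that contains it, since it is the
element of rank \<open>i\<close>. Prescribing the truncation of the random set therefore prescribes many of the
independent variables.\<close>

lemma rank_determines_c:
  assumes "1 \<le> i" "c i \<le> x"
  shows "(THE t. t \<in> c ` {1..} \<inter> {0..x} \<and> card {u \<in> c ` {1..} \<inter> {0..x}. u \<le> t} = i) = c i"
proof -
  have rank: "card {u \<in> c ` {1..} \<inter> {0..x}. u \<le> c j} = j" if j: "1 \<le> j" "c j \<le> x" for j
  proof -
    have "{u \<in> c ` {1..} \<inter> {0..x}. u \<le> c j} = c ` {1..j}"
    proof (intro equalityI subsetI)
      fix u assume "u \<in> {u \<in> c ` {1..} \<inter> {0..x}. u \<le> c j}"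
      then obtain m where "1 \<le> m" "u = c m" "c m \<le> c j" by auto
      then show "u \<in> c ` {1..j}" using j c_le_iff[of m j] by auto
    next
      fix u assume "u \<in> c ` {1..j}"
      then obtain m where m: "1 \<le> m" "m \<le> j" "u = c m" by auto
      then have "c m \<le> c j" using j c_le_iff[of m j] by auto
      then show "u \<in> {u \<in> c ` {1..} \<inter> {0..x}. u \<le> c j}"
        using m j c_nonneg[of m] by auto
    qed
    then show ?thesis
      using inj_on_subset[OF inj_c, of "{1..j}"] by (simp add: card_image)
  qed
  show ?thesis
  proof (rule the_equality)
    show "c i \<in> c ` {1..} \<inter> {0..x} \<and> card {u \<in> c ` {1..} \<inter> {0..x}. u \<le> c i} = i"
      using rank[OF assms] assms c_nonneg[of i] by simp
  next
    fix t assume t: "t \<in> c ` {1..} \<inter> {0..x} \<and> card {u \<in> c ` {1..} \<inter> {0..x}. u \<le> t} = i"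
    then obtain m where m: "1 \<le> m" "t = c m" "c m \<le> x" by auto
    then have "m = i" using rank[OF m(1,3)] t by metis
    then show "t = c i" using m by simp
  qed
qed

text \<open>Write a large term as \<open>a + b\<close> and replace \<open>a\<close> by another element \<open>a'\<close> of the finite summand: this
gives a different term at distance at most \<open>H\<close>, and the neighbours of \<open>c j\<close> are at least as close.\<close>

lemma finite_summand_gives_close_pair:
  assumes A: "A \<subseteq> {0..int H}" "2 \<le> card A"
    and agree: "\<And>z. int H \<le> z \<Longrightarrow> z \<in> c ` {1..} \<longleftrightarrow> z \<in> A + B"
    and j: "2 \<le> j" "2 * int H \<le> c j"
  shows "\<bar>c j - c (j - 1)\<bar> \<le> int H \<or> \<bar>c j - c (Suc j)\<bar> \<le> int H"
proof -
  have "c j \<in> A + B" using agree[of "c j"] j by auto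
  then obtain a b where ab: "a \<in> A" "b \<in> B" "c j = a + b" unfolding set_plus_def by blast
  have "\<exists>a'\<in>A. a' \<noteq> a"
  proof (rule ccontr)
    assume "\<not> ?thesis"
    then have "A \<subseteq> {a}" by blast
    then have "card A \<le> card {a}" by (rule card_mono[rotated]) simp
    then show False using A(2) by simp
  qed
  then obtain a' where a': "a' \<in> A" "a' \<noteq> a" by blast
  have "a \<in> {0..int H}" "a' \<in> {0..int H}" using a' ab A by auto
  then have "int H \<le> a' + b" and near: "\<bar>a' + b - c j\<bar> \<le> int H" using ab j by auto
  then have "a' + b \<in> c ` {1..}" using agree a' ab by (auto intro: set_plus_intro)
  then obtain m where m: "1 \<le> m" "a' + b = c m" by auto
  have "m \<noteq> j" using m a' ab by auto
  then consider "m \<le> j - 1" | "Suc j \<le> m" by linarith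
  then show ?thesis
  proof cases
    case 1
    then have "c m \<le> c (j - 1)" "c (j - 1) < c j"
      using m j c_le_iff[of m "j - 1"] c_less_iff[of "j - 1" j] by auto
    then show ?thesis using near m by linarith
  next
    case 2
    then have "c (Suc j) \<le> c m" "c j < c (Suc j)"
      using m j c_le_iff[of "Suc j" m] c_less_iff[of j "Suc j"] by auto
    then show ?thesis using near m by linarith
  qed
qed

text \<open>Four translates of \<open>b\<close> are four different terms; the first of them has index \<open>n\<close>, so the last of them
has index at least \<open>n + 3\<close>.\<close>

lemma four_terms_in_window:
  assumes A: "A' \<subseteq> {a..<h}" "a \<in> A'" "4 \<le> card A'"
    and sub: "\<And>z. z \<in> A' \<Longrightarrow> z + b \<in> c ` {1..}"
    and n: "1 \<le> n" "c n = a + b"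
  shows "c (n + 3) < h + b"
proof (rule ccontr)
  assume neg: "\<not> ?thesis"
  have "(\<lambda>z. z + b) ` A' \<subseteq> c ` {n..n + 2}"
  proof clarify
    fix z assume z: "z \<in> A'"
    then obtain m where m: "1 \<le> m" "z + b = c m" using sub by fastforce
    have "a \<le> z" "z < h" using z A by auto
    then have "c n \<le> c m" "c m < c (n + 3)" using m n neg by auto
    then have "n \<le> m" "m < n + 3"
      using c_le_iff[of n m] c_less_iff[of m "n + 3"] m(1) n(1) by auto
    then show "z + b \<in> c ` {n..n + 2}" using m by auto
  qed
  then have "card ((\<lambda>z. z + b) ` A') \<le> card {n..n + 2}"
    by (rule surj_card_le[rotated]) simp
  moreover have "card ((\<lambda>z. z + b) ` A') = card A'"
    by (intro card_image) (auto simp: inj_on_def)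
  ultimately show False using A by simp
qed

text \<open>Each \<open>b \<in> B\<close> is the base of a window of length \<open>H\<close> with four terms \<open>c n, \<dots>, c (n + 3)\<close>. Since
\<open>c n\<close> lies below the midpoint of \<open>s n, s (n + 1)\<close> and \<open>c (n + 3)\<close> above the midpoint of
\<open>s (n + 2), s (n + 3)\<close>, the index \<open>k = n + 1\<close> satisfies \<open>s (k + 2) - s k \<le> 2 * H\<close>.
The summand \<open>2 * H\<close> pays for the elements of \<open>B\<close> within \<open>H\<close> of the two ends of \<open>{0..x}\<close>.\<close>

lemma other_summand_sparse:
  assumes A: "4 \<le> card (A \<inter> {0..<int H})"
    and agree: "\<And>z. int H \<le> z \<Longrightarrow> z \<in> c ` {1..} \<longleftrightarrow> z \<in> A + B"
  shows "card (B \<inter> {0..int x})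
           \<le> card {k. 1 \<le> k \<and> real (s k) \<le> real x \<and> s (k + 2) - s k \<le> 2 * H} + 2 * H"
    (is "_ \<le> card ?K + _")
proof -
  define A' where "A' = A \<inter> {0..<int H}"
  define a where "a = Min A'"
  have fin: "finite A'" and ne: "A' \<noteq> {}" using A unfolding A'_def by auto
  have aA: "a \<in> A'" using Min_in[OF fin ne] by (simp add: a_def)
  have sub: "A' \<subseteq> {a..<int H}" using fin by (auto simp: a_def A'_def)
  have finK: "finite ?K"
    by (rule finite_subset[OF _ finite_enumeration_le[OF s_mono, of "real x"]]) auto
  define B' where "B' = {b \<in> B. int H \<le> b \<and> b \<le> int x - int H}"
  define g where "g b = Suc (inv_into {1..} c (a + b))" for b
  have sums: "z + b \<in> c ` {1..}" if "b \<in> B'" "z \<in> A'" for z b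
    using that agree[of "z + b"] by (auto simp: B'_def A'_def intro: set_plus_intro)
  have "g b \<in> ?K" if b: "b \<in> B'" for b
  proof -
    define n where "n = inv_into {1..} c (a + b)"
    have "a + b \<in> c ` {1..}" using sums[OF b aA] .
    then have n: "1 \<le> n" "c n = a + b"
      using inv_into_into[of "a + b" c "{1..}"] by (auto simp: n_def f_inv_into_f)
    have "c (n + 3) < int H + b"
      by (rule four_terms_in_window[OF sub aA _ _ n]) (use A sums b in \<open>auto simp: A'_def\<close>)
    moreover have "0 \<le> a" using aA by (simp add: A'_def)
    moreover have "2 * c n \<le> int (s n) + int (s (Suc n))" using upper n by blast
    moreover have "int (s (n + 2)) + int (s (n + 3)) < 2 * c (n + 3)"
      using lower[of "n + 2"] by (simp add: numeral_eq_Suc)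
    moreover have "s n < s (Suc n)" "s (Suc n) < s (n + 2)"
      using s_less[of n] s_less[of "Suc n"] n by auto
    moreover have "c (n + 2) < c (n + 3)" using c_less[of "n + 2" "n + 3"] by simp
    moreover have "int (s (Suc n)) < c (n + 2)" using s_less_c[of "Suc n"] by simp
    ultimately have "s (n + 3) - s (Suc n) \<le> 2 * H" "int (s (Suc n)) \<le> int x"
      using n b by (auto simp: B'_def)
    moreover have "g b = Suc n" by (simp add: g_def n_def)
    moreover have "Suc n + 2 = n + 3" by simp
    ultimately show ?thesis by (simp only: mem_Collect_eq) simp
  qed
  moreover have "inj_on g B'"
  proof (rule inj_onI)
    fix b b' assume b: "b \<in> B'" "b' \<in> B'" "g b = g b'"
    then have "inv_into {1..} c (a + b) = inv_into {1..} c (a + b')" by (simp add: g_def)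
    then have "a + b = a + b'"
      by (rule inv_into_injective) (use sums[OF b(1) aA] sums[OF b(2) aA] in auto)
    then show "b = b'" by simp
  qed
  ultimately have "card B' \<le> card ?K"
    using finK by (intro card_inj_on_le[of g]) auto
  moreover have "card (B \<inter> {0..int x}) \<le> card (({0..<int H} \<union> {int x - int H<..int x}) \<union> B')"
  proof (rule card_mono)
    have "B' \<subseteq> {int H..int x - int H}" by (auto simp: B'_def)
    then show "finite (({0..<int H} \<union> {int x - int H<..int x}) \<union> B')"
      using finite_subset by auto
  qed (auto simp: B'_def)
  moreover have "\<dots> \<le> (card {0..<int H} + card {int x - int H<..int x}) + card B'"
    by (intro order_trans[OF card_Un_le] add_mono card_Un_le order_refl)
  ultimately show ?thesis by simp
qed

end

section \<open>Counting truncated sumsets\<close>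

text \<open>Rankin's trick: weight a subset \<open>T\<close> by \<open>y ^ card T\<close>, which is at least \<open>y ^ t\<close> for the counted sets,
while the total weight of all subsets is \<open>(1 + y) ^ card U\<close>.\<close>

lemma card_small_subsets_le:
  fixes y :: real
  assumes U: "finite U" and y: "0 < y" "y \<le> 1"
  shows "real (card {T. T \<subseteq> U \<and> card T \<le> t}) \<le> (1 + y) ^ card U / y ^ t"
proof -
  have gen: "(\<Sum>T\<in>Pow U. y ^ card T) = (1 + y) ^ card U"
    using U
  proof (induction rule: finite_induct)
    case (insert u U)
    have "(\<Sum>T\<in>Pow (insert u U). y ^ card T)
        = (\<Sum>T\<in>Pow U. y ^ card T) + (\<Sum>T\<in>insert u ` Pow U. y ^ card T)"
      unfolding Pow_insert using insert by (intro sum.union_disjoint) auto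
    also have "(\<Sum>T\<in>insert u ` Pow U. y ^ card T) = (\<Sum>T\<in>Pow U. y ^ card (insert u T))"
      using insert by (subst sum.reindex) (auto simp: inj_on_def)
    also have "\<dots> = (\<Sum>T\<in>Pow U. y * y ^ card T)"
    proof (rule sum.cong)
      fix T assume "T \<in> Pow U"
      then have "finite T" "u \<notin> T" using insert finite_subset by auto
      then show "y ^ card (insert u T) = y * y ^ card T" by simp
    qed simp
    finally show ?case
      using insert by (simp add: sum_distrib_left[symmetric] algebra_simps)
  qed simp
  let ?F = "{T. T \<subseteq> U \<and> card T \<le> t}"
  have "real (card ?F) * y ^ t = (\<Sum>T\<in>?F. y ^ t)" by simp
  also have "\<dots> \<le> (\<Sum>T\<in>?F. y ^ card T)"
    using y by (intro sum_mono power_decreasing) auto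
  also have "\<dots> \<le> (\<Sum>T\<in>Pow U. y ^ card T)"
    using y U by (intro sum_mono2) auto
  finally show ?thesis using y gen by (simp add: pos_le_divide_eq)
qed

text \<open>All candidates for the part in \<open>{0..x}\<close> of a set that agrees with \<open>A + B\<close> from \<open>H\<close> on: the truncations
of \<open>A\<close> and \<open>B\<close> determine the part from \<open>H\<close> on, and the part \<open>F\<close> below \<open>H\<close> is arbitrary.\<close>

definition truncated_sumsets :: "nat \<Rightarrow> nat \<Rightarrow> nat \<Rightarrow> int set set" where
  "truncated_sumsets H x t =
     (\<lambda>(F, A, B). F \<union> ((A + B) \<inter> {int H..int x})) `
       (Pow {0..<int H} \<times> {T. T \<subseteq> {0..int x} \<and> card T \<le> t} \<times> {T. T \<subseteq> {0..int x} \<and> card T \<le> t})"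

lemma finite_truncated_sumsets: "finite (truncated_sumsets H x t)"
  unfolding truncated_sumsets_def by (intro finite_imageI finite_cartesian_product) auto

lemma card_truncated_sumsets_le:
  fixes y :: real
  assumes "0 < y" "y \<le> 1"
  shows "real (card (truncated_sumsets H x t)) \<le> 2 ^ H * ((1 + y) ^ (x + 1) / y ^ t)\<^sup>2"
proof -
  let ?S = "{T. T \<subseteq> {0..int x} \<and> card T \<le> t}"
  have S: "real (card ?S) \<le> (1 + y) ^ (x + 1) / y ^ t"
    using card_small_subsets_le[of "{0..int x}" y t] assms by (simp add: nat_add_distrib)
  have "card (truncated_sumsets H x t) \<le> card (Pow {0..<int H} \<times> ?S \<times> ?S)"
    unfolding truncated_sumsets_def by (intro card_image_le finite_cartesian_product) auto
  also have "\<dots> = 2 ^ H * (card ?S)\<^sup>2"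
    by (simp add: card_cartesian_product card_Pow power2_eq_square)
  finally have "real (card (truncated_sumsets H x t)) \<le> real (2 ^ H * (card ?S)\<^sup>2)"
    by (simp only: of_nat_le_iff)
  also have "\<dots> = 2 ^ H * (real (card ?S))\<^sup>2" by simp
  also have "\<dots> \<le> 2 ^ H * ((1 + y) ^ (x + 1) / y ^ t)\<^sup>2"
    using S by (intro mult_left_mono power_mono) auto
  finally show ?thesis .
qed

lemma truncation_in_truncated_sumsets:
  assumes nonneg: "A \<subseteq> {0..}" "B \<subseteq> {0..}"
    and card: "card (A \<inter> {0..int x}) \<le> t" "card (B \<inter> {0..int x}) \<le> t"
    and agree: "\<And>z. int H \<le> z \<Longrightarrow> z \<in> C \<longleftrightarrow> z \<in> A + B"
  shows "C \<inter> {0..int x} \<in> truncated_sumsets H x t"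
proof -
  define F where "F = C \<inter> {0..int x} \<inter> {0..<int H}"
  let ?A = "A \<inter> {0..int x}" and ?B = "B \<inter> {0..int x}"
  have "C \<inter> {0..int x} = F \<union> ((?A + ?B) \<inter> {int H..int x})"
  proof (intro equalityI subsetI)
    fix z assume z: "z \<in> C \<inter> {0..int x}"
    show "z \<in> F \<union> ((?A + ?B) \<inter> {int H..int x})"
    proof (cases "z < int H")
      case True
      then show ?thesis using z by (simp add: F_def)
    next
      case False
      then have "z \<in> A + B" using agree[of z] z by simp
      then obtain a b where ab: "a \<in> A" "b \<in> B" "z = a + b" unfolding set_plus_def by blast
      then have "0 \<le> a" "0 \<le> b" using nonneg by auto
      then have "a \<in> ?A" "b \<in> ?B" using ab z by auto
      then have "z \<in> ?A + ?B" unfolding ab(3) by (rule set_plus_intro)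
      then show ?thesis using z False by simp
    qed
  next
    fix z assume z: "z \<in> F \<union> ((?A + ?B) \<inter> {int H..int x})"
    show "z \<in> C \<inter> {0..int x}"
    proof (cases "z \<in> F")
      case True
      then show ?thesis by (simp add: F_def)
    next
      case False
      have "?A + ?B \<subseteq> A + B" by (intro set_plus_mono2) auto
      then show ?thesis using z False agree[of z] by auto
    qed
  qed
  moreover have "(F, ?A, ?B) \<in> Pow {0..<int H} \<times> {T. T \<subseteq> {0..int x} \<and> card T \<le> t}
      \<times> {T. T \<subseteq> {0..int x} \<and> card T \<le> t}"
    using card by (auto simp: F_def)
  ultimately show ?thesis unfolding truncated_sumsets_def by (intro image_eqI) auto
qed

section \<open>Independent integer variables with bounded point probabilities\<close>

context prob_space begin

text \<open>The property itself need not be measurable; it only has to be covered by measurable events of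
arbitrarily small probability.\<close>

lemma AE_not_if_covered_by_small_events:
  assumes "\<And>e. 0 < e \<Longrightarrow> \<exists>E\<in>events. prob E \<le> e \<and> (AE \<omega> in M. P \<omega> \<longrightarrow> \<omega> \<in> E)"
  shows "AE \<omega> in M. \<not> P \<omega>"
proof -
  have "\<exists>E\<in>events. prob E \<le> 1 / real (Suc n) \<and> (AE \<omega> in M. P \<omega> \<longrightarrow> \<omega> \<in> E)" for n
    by (rule assms) simp
  then obtain E where E: "\<And>n. E n \<in> events" "\<And>n. prob (E n) \<le> 1 / real (Suc n)"
    "\<And>n. AE \<omega> in M. P \<omega> \<longrightarrow> \<omega> \<in> E n"
    by metis
  have meas: "(\<Inter>n. E n) \<in> events" using E(1) by auto
  have "prob (\<Inter>n. E n) \<le> 1 / real (Suc n)" for n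
    using finite_measure_mono[of "\<Inter>n. E n" "E n"] E(1,2)[of n] by force
  then have "prob (\<Inter>n. E n) \<le> 0"
    by (intro LIMSEQ_le_const[OF LIMSEQ_inverse_real_of_nat]) (auto simp: inverse_eq_divide)
  then have "prob (\<Inter>n. E n) = 0" by (simp add: measure_le_0_iff)
  then have "AE \<omega> in M. \<omega> \<notin> (\<Inter>n. E n)" using meas by (simp add: prob_eq_0)
  moreover have "AE \<omega> in M. \<forall>n. P \<omega> \<longrightarrow> \<omega> \<in> E n" using E(3) by (subst AE_all_countable) blast
  ultimately show ?thesis by eventually_elim auto
qed

lemma prob_prescribed_values_le:
  assumes indep: "indep_vars (\<lambda>_. count_space UNIV) X I"
    and J: "finite J" "J \<subseteq> I"
    and p: "\<And>i. i \<in> J \<Longrightarrow> prob {\<omega> \<in> space M. X i \<omega> = k i} \<le> p i"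
  shows "prob {\<omega> \<in> space M. \<forall>i\<in>J. X i \<omega> = k i} \<le> (\<Prod>i\<in>J. p i)"
proof (cases "J = {}")
  case False
  have "{\<omega> \<in> space M. \<forall>i\<in>J. X i \<omega> = k i} = (\<Inter>i\<in>J. X i -` {k i} \<inter> space M)"
    using False by auto
  also have "prob \<dots> = (\<Prod>i\<in>J. prob (X i -` {k i} \<inter> space M))"
    by (rule indep_varsD[OF indep False J]) simp
  also have "\<dots> \<le> (\<Prod>i\<in>J. p i)"
    using p by (intro prod_mono) (auto simp: vimage_def Int_def conj_commute)
  finally show ?thesis .
qed simp

text \<open>Given the value of \<open>X i\<close>, closeness leaves \<open>2 * H + 1\<close> possible values to \<open>X j\<close>.\<close>

lemma prob_close_pair_le:
  fixes X :: "'i \<Rightarrow> 'a \<Rightarrow> int"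
  assumes indep: "indep_vars (\<lambda>_. count_space UNIV) X I"
    and ij: "i \<in> I" "j \<in> I" "i \<noteq> j"
    and F: "finite F" "AE \<omega> in M. X i \<omega> \<in> F"
    and p: "\<And>k. prob {\<omega> \<in> space M. X j \<omega> = k} \<le> p"
  shows "prob {\<omega> \<in> space M. \<bar>X j \<omega> - X i \<omega> + d\<bar> \<le> int H} \<le> real (2 * H + 1) * p"
proof -
  have [measurable]: "random_variable (count_space UNIV) (X i)"
    "random_variable (count_space UNIV) (X j)"
    using indep ij by (auto simp: indep_vars_def)
  let ?Z = "{- int H..int H}"
  let ?G = "\<lambda>(k, z). {\<omega> \<in> space M. X i \<omega> = k \<and> X j \<omega> = k - d + z}"
  have G: "prob (?G (k, z)) \<le> prob {\<omega> \<in> space M. X i \<omega> = k} * p" for k z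
  proof -
    let ?v = "\<lambda>m. if m = i then k else k - d + z"
    let ?q = "\<lambda>m. if m = i then prob {\<omega> \<in> space M. X i \<omega> = k} else p"
    have "prob {\<omega> \<in> space M. \<forall>m\<in>{i, j}. X m \<omega> = ?v m} \<le> (\<Prod>m\<in>{i, j}. ?q m)"
      using p ij by (intro prob_prescribed_values_le[OF indep]) auto
    then show ?thesis using ij by simp
  qed
  have "prob {\<omega> \<in> space M. \<bar>X j \<omega> - X i \<omega> + d\<bar> \<le> int H} \<le> prob (\<Union>kz\<in>F \<times> ?Z. ?G kz)"
  proof (rule finite_measure_mono_AE)
    show "AE \<omega> in M. \<omega> \<in> {\<omega> \<in> space M. \<bar>X j \<omega> - X i \<omega> + d\<bar> \<le> int H}
                        \<longrightarrow> \<omega> \<in> (\<Union>kz\<in>F \<times> ?Z. ?G kz)"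
      using F(2)
    proof eventually_elim
      case (elim \<omega>)
      show ?case
      proof
        assume w: "\<omega> \<in> {\<omega> \<in> space M. \<bar>X j \<omega> - X i \<omega> + d\<bar> \<le> int H}"
        then have "(X i \<omega>, X j \<omega> - X i \<omega> + d) \<in> F \<times> ?Z"
          "\<omega> \<in> ?G (X i \<omega>, X j \<omega> - X i \<omega> + d)"
          using elim by auto
        then show "\<omega> \<in> (\<Union>kz\<in>F \<times> ?Z. ?G kz)" by blast
      qed
    qed
    show "(\<Union>kz\<in>F \<times> ?Z. ?G kz) \<in> events"
      using F(1) by (intro sets.finite_UN) (auto simp: split_beta)
  qed
  also have "\<dots> \<le> (\<Sum>kz\<in>F \<times> ?Z. prob (?G kz))"
    using F(1) by (intro finite_measure_subadditive_finite) (auto simp: split_beta)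
  also have "\<dots> \<le> (\<Sum>(k, z)\<in>F \<times> ?Z. prob {\<omega> \<in> space M. X i \<omega> = k} * p)"
    using G by (intro sum_mono) auto
  also have "\<dots> = (\<Sum>k\<in>F. prob {\<omega> \<in> space M. X i \<omega> = k}) * (real (2 * H + 1) * p)"
    by (simp add: sum.cartesian_product[symmetric] sum_distrib_right sum_distrib_left algebra_simps)
  also have "(\<Sum>k\<in>F. prob {\<omega> \<in> space M. X i \<omega> = k}) = prob (\<Union>k\<in>F. {\<omega> \<in> space M. X i \<omega> = k})"
    using F(1) by (intro finite_measure_finite_Union[symmetric]) (auto simp: disjoint_family_on_def)
  also have "\<dots> * (real (2 * H + 1) * p) \<le> 1 * (real (2 * H + 1) * p)"
    using order_trans[OF measure_nonneg p] by (intro mult_right_mono) auto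
  finally show ?thesis by simp
qed

end

text \<open>The union bound over all candidates. If \<open>s N \<le> x\<close>, then the terms with index below \<open>N\<close> lie in
\<open>{0..x}\<close>, so each candidate fixes the perturbations with these indices. The index \<open>1\<close> is left out
because in the application only the later bounds \<open>p i\<close> are known to be at most \<open>1\<close>.\<close>

lemma (in prob_space) prob_sparse_sumset_le:
  fixes s :: "nat \<Rightarrow> nat" and \<epsilon> :: "nat \<Rightarrow> 'a \<Rightarrow> int" and y :: real
  assumes indep: "indep_vars (\<lambda>_. count_space UNIV) \<epsilon> {1..}"
    and inter: "AE \<omega> in M. interlaced s (\<lambda>n. int (s n) + \<epsilon> n \<omega>)"
    and p: "\<And>n k. 1 \<le> n \<Longrightarrow> prob {\<omega> \<in> space M. \<epsilon> n \<omega> = k} \<le> p n"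
    and N: "s N \<le> x"
    and y: "0 < y" "y \<le> 1"
  shows "\<exists>E\<in>events. prob E \<le> 2 ^ H * ((1 + y) ^ (x + 1) / y ^ t)\<^sup>2 * (\<Prod>i\<in>{2..<N}. p i) \<and>
    (AE \<omega> in M. (\<exists>A B. A \<subseteq> {0..} \<and> B \<subseteq> {0..} \<and>
        card (A \<inter> {0..int x}) \<le> t \<and> card (B \<inter> {0..int x}) \<le> t \<and>
        (\<forall>z\<ge>int H. z \<in> (\<lambda>n. int (s n) + \<epsilon> n \<omega>) ` {1..} \<longleftrightarrow> z \<in> A + B)) \<longrightarrow> \<omega> \<in> E)"
proof -
  have meas: "random_variable (count_space UNIV) (\<epsilon> i)" if "1 \<le> i" for i
    using indep that by (auto simp: indep_vars_def)
  \<comment> \<open>the value that the candidate \<open>T\<close> forces on the \<open>i\<close>-th perturbation\<close>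
  define v where "v T i = (THE t. t \<in> T \<and> card {u \<in> T. u \<le> t} = i) - int (s i)"
    for T :: "int set" and i
  define G where "G T = {\<omega> \<in> space M. \<forall>i\<in>{2..<N}. \<epsilon> i \<omega> = v T i}" for T
  let ?F = "truncated_sumsets H x t"
  let ?P = "\<Prod>i\<in>{2..<N}. p i"
  have G: "G T \<in> events" "prob (G T) \<le> ?P" for T
  proof -
    have "{\<omega> \<in> space M. \<epsilon> i \<omega> = v T i} \<in> events" if "i \<in> {2..<N}" for i
    proof -
      have [measurable]: "random_variable (count_space UNIV) (\<epsilon> i)" using meas that by simp
      show ?thesis by measurable
    qed
    then show "G T \<in> events"
      unfolding G_def by (intro sets.sets_Collect_finite_All) auto
    show "prob (G T) \<le> ?P"
      unfolding G_def using p by (intro prob_prescribed_values_le[OF indep]) auto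
  qed
  define E where "E = (\<Union>T\<in>?F. G T)"
  have "E \<in> events" unfolding E_def using G(1) by (intro sets.finite_UN finite_truncated_sumsets)
  moreover have "prob E \<le> 2 ^ H * ((1 + y) ^ (x + 1) / y ^ t)\<^sup>2 * ?P"
  proof -
    have P0: "0 \<le> ?P"
      by (intro prod_nonneg order_trans[OF measure_nonneg p]) auto
    have "prob E \<le> (\<Sum>T\<in>?F. prob (G T))"
      unfolding E_def using G(1)
      by (intro finite_measure_subadditive_finite finite_truncated_sumsets) auto
    also have "\<dots> \<le> (\<Sum>T\<in>?F. ?P)" using G(2) by (intro sum_mono)
    also have "\<dots> = real (card ?F) * ?P" by simp
    also have "\<dots> \<le> 2 ^ H * ((1 + y) ^ (x + 1) / y ^ t)\<^sup>2 * ?P"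
      by (intro mult_right_mono card_truncated_sumsets_le y P0)
    finally show ?thesis .
  qed
  moreover have "AE \<omega> in M. (\<exists>A B. A \<subseteq> {0..} \<and> B \<subseteq> {0..} \<and>
        card (A \<inter> {0..int x}) \<le> t \<and> card (B \<inter> {0..int x}) \<le> t \<and>
        (\<forall>z\<ge>int H. z \<in> (\<lambda>n. int (s n) + \<epsilon> n \<omega>) ` {1..} \<longleftrightarrow> z \<in> A + B)) \<longrightarrow> \<omega> \<in> E"
    using inter AE_space
  proof eventually_elim
    case (elim \<omega>)
    interpret interlaced s "\<lambda>n. int (s n) + \<epsilon> n \<omega>" by (rule elim)
    show ?case
    proof clarify
      fix A B :: "int set"
      assume AB: "A \<subseteq> {0..}" "B \<subseteq> {0..}" "card (A \<inter> {0..int x}) \<le> t" "card (B \<inter> {0..int x}) \<le> t"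
        "\<forall>z\<ge>int H. z \<in> (\<lambda>n. int (s n) + \<epsilon> n \<omega>) ` {1..} \<longleftrightarrow> z \<in> A + B"
      let ?T = "(\<lambda>n. int (s n) + \<epsilon> n \<omega>) ` {1..} \<inter> {0..int x}"
      have "?T \<in> ?F"
        by (rule truncation_in_truncated_sumsets[OF AB(1-4)]) (use AB(5) in blast)
      moreover have "\<omega> \<in> G ?T"
      proof -
        have "\<epsilon> i \<omega> = v ?T i" if i: "i \<in> {2..<N}" for i
        proof -
          have "int (s i) + \<epsilon> i \<omega> \<le> int (s (Suc i))" using c_less_s[of i] i by simp
          moreover have "s (Suc i) \<le> s N"
            using i by (intro strict_mono_on_leD[OF s_mono]) auto
          ultimately have "int (s i) + \<epsilon> i \<omega> \<le> int x" using N by simp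
          then show ?thesis
            unfolding v_def using i by (subst rank_determines_c) auto
        qed
        then show ?thesis using elim by (simp add: G_def)
      qed
      ultimately show "\<omega> \<in> E" unfolding E_def by blast
    qed
  qed
  ultimately show ?thesis by blast
qed

section \<open>Consequences of the growth conditions\<close>

text \<open>The sequences whose counting function \<open>S\<close> satisfies \<open>f(x) = x / S(x) \<rightarrow> \<infinity>\<close>, that is, those whose range
has density zero; the rate is measured through \<open>S(x) / log f(x)\<close>: if \<open>t\<close> is small
compared with it, then \<open>{0..x}\<close> has only \<open>exp (o(S(x)))\<close> subsets with at most \<open>t\<close> elements.\<close>

locale sparse_sequence =
  fixes s :: "nat \<Rightarrow> nat"
  assumes s_mono: "strict_mono_on {1..} s"
    and sparse: "filterlim (\<lambda>x. x / counting (s ` {1..}) x) at_top at_top"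
begin

abbreviation cnt :: "real \<Rightarrow> real" where "cnt \<equiv> counting (s ` {1..})"

text \<open>Equality fails by one if \<open>s 1 = 0\<close>, since the counting function ignores \<open>0\<close>.\<close>

lemma counting_le_card_indices: "cnt x \<le> real (card {k. 1 \<le> k \<and> real (s k) \<le> x})"
proof -
  have "{n \<in> s ` {1..}. 1 \<le> n \<and> real n \<le> x} \<subseteq> s ` {k. 1 \<le> k \<and> real (s k) \<le> x}" by auto
  then have "card {n \<in> s ` {1..}. 1 \<le> n \<and> real n \<le> x} \<le> card {k. 1 \<le> k \<and> real (s k) \<le> x}"
    using finite_enumeration_le[OF s_mono] by (rule surj_card_le[rotated])
  then show ?thesis by (simp add: counting_def)
qed

lemma counting_at_top: "filterlim cnt at_top at_top"
  unfolding filterlim_at_top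
proof
  fix Z :: real
  define m where "m = nat \<lceil>Z\<rceil>"
  \<comment> \<open>start at index \<open>2\<close>, because \<open>s 1\<close> may be \<open>0\<close>, which is not counted\<close>
  have inj: "inj_on s {2..Suc m}"
    using strict_mono_on_imp_inj_on[OF s_mono] by (rule inj_on_subset) auto
  have "Z \<le> cnt x" if x: "real (s (Suc m)) \<le> x" for x
  proof -
    have "s ` {2..Suc m} \<subseteq> {n \<in> s ` {1..}. 1 \<le> n \<and> real n \<le> x}"
    proof clarify
      fix k assume k: "k \<in> {2..Suc m}"
      have "s k \<le> s (Suc m)" using k by (intro strict_mono_on_leD[OF s_mono]) auto
      then show "s k \<in> s ` {1..} \<and> 1 \<le> s k \<and> real (s k) \<le> x"
        using k x enumeration_ge[OF s_mono, of k] by auto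
    qed
    moreover have "finite {n \<in> s ` {1..}. 1 \<le> n \<and> real n \<le> x}"
      by (rule finite_subset[of _ "s ` {k. 1 \<le> k \<and> real (s k) \<le> x}"])
         (use finite_enumeration_le[OF s_mono] in auto)
    ultimately have "card (s ` {2..Suc m}) \<le> card {n \<in> s ` {1..}. 1 \<le> n \<and> real n \<le> x}"
      by (rule card_mono[rotated])
    moreover have "Z \<le> real m" unfolding m_def by linarith
    ultimately show ?thesis using card_image[OF inj] by (simp add: counting_def)
  qed
  then show "eventually (\<lambda>x. Z \<le> cnt x) at_top"
    using eventually_ge_at_top[of "real (s (Suc m))"] by (rule eventually_mono[rotated])
qed

lemma eventually_cnt_ge: "eventually (\<lambda>x. Z \<le> cnt x) at_top"
  using counting_at_top unfolding filterlim_at_top by blast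

lemma eventually_ratio_ge: "eventually (\<lambda>x. Z \<le> x / cnt x) at_top"
  using sparse unfolding filterlim_at_top by blast

text \<open>If \<open>\<delta>\<close> were bounded, every product would be at least a constant \<open>q > 0\<close> and the sum at least
\<open>q * S(x)\<close>, which is not negligible against \<open>S(x) / log f(x)\<close> since \<open>f \<rightarrow> \<infinity>\<close>.\<close>

lemma unbounded_if_products_negligible:
  fixes \<delta> :: "nat \<Rightarrow> real"
  assumes pos: "\<And>n. 1 \<le> n \<Longrightarrow> 0 < \<delta> n"
    and D2: "(\<lambda>x. \<Sum>k | 1 \<le> k \<and> real (s k) \<le> x. \<Prod>i = 0..l - 1. inverse (\<delta> (k + i)))
               \<in> o[at_top](\<lambda>x. cnt x / ln (x / cnt x))"
  shows "\<exists>j\<ge>J. K < \<delta> j"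
proof (rule ccontr)
  assume "\<not> ?thesis"
  then have le: "\<delta> j \<le> K" if "J \<le> j" for j using that by (meson not_less)
  define K' where "K' = Max (insert 1 (insert K (\<delta> ` {1..J})))"
  have K': "1 \<le> K'" "K \<le> K'" unfolding K'_def by (intro Max_ge; simp)+
  have bound: "\<delta> j \<le> K'" if j: "1 \<le> j" for j
  proof (cases "J \<le> j")
    case True
    then show ?thesis using le K' by force
  next
    case False
    then have "\<delta> j \<in> \<delta> ` {1..J}" using j by auto
    then show ?thesis unfolding K'_def by (intro Max_ge) auto
  qed
  define q where "q = inverse K' ^ card {0..l - 1}"
  have q: "0 < q" using K' by (simp add: q_def)
  let ?sum = "\<lambda>x. \<Sum>k | 1 \<le> k \<and> real (s k) \<le> x. \<Prod>i = 0..l - 1. inverse (\<delta> (k + i))"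
  have sum: "cnt x * q \<le> ?sum x" for x
  proof -
    have "cnt x * q \<le> real (card {k. 1 \<le> k \<and> real (s k) \<le> x}) * q"
      using counting_le_card_indices q by (intro mult_right_mono) auto
    also have "\<dots> = (\<Sum>k | 1 \<le> k \<and> real (s k) \<le> x. q)" by simp
    also have "\<dots> \<le> ?sum x"
    proof (rule sum_mono)
      fix k assume "k \<in> {k. 1 \<le> k \<and> real (s k) \<le> x}"
      then have k: "1 \<le> k" by simp
      have "q = (\<Prod>i = 0..l - 1. inverse K')" by (simp add: q_def)
      also have "\<dots> \<le> (\<Prod>i = 0..l - 1. inverse (\<delta> (k + i)))"
        using K' k pos bound by (intro prod_mono conjI le_imp_inverse_le) auto
      finally show "q \<le> (\<Prod>i = 0..l - 1. inverse (\<delta> (k + i)))" .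
    qed
    finally show ?thesis .
  qed
  have "eventually (\<lambda>x. norm (?sum x) \<le> q * norm (cnt x / ln (x / cnt x))) at_top"
    using landau_o.smallD[OF D2 q] .
  moreover note eventually_cnt_ge[of 1] eventually_ratio_ge[of "exp 2"]
  ultimately have "eventually (\<lambda>x::real. False) at_top"
  proof eventually_elim
    case (elim x)
    have "0 < x / cnt x" using elim(3) exp_gt_zero[of "2::real"] by linarith
    then have ln: "2 \<le> ln (x / cnt x)" using elim(3) by (simp add: ln_ge_iff)
    have "cnt x * q \<le> q * (cnt x / ln (x / cnt x))"
      using elim sum[of x] ln by (simp add: abs_le_iff)
    also have "\<dots> \<le> q * (cnt x / 2)"
      using q ln elim by (intro mult_left_mono divide_left_mono) auto
    finally show False using q elim by (simp add: field_simps)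
  qed
  then show False by simp
qed

text \<open>The first term of the sum is a positive constant, so the condition on the sum forces
\<open>S(x) / log f(x) \<rightarrow> \<infinity>\<close>. This does not follow from \<open>f \<rightarrow> \<infinity>\<close>: for very thin sequences the
quotient tends to \<open>0\<close>.\<close>

lemma constants_negligible:
  fixes \<delta> :: "nat \<Rightarrow> real"
  assumes pos: "\<And>n. 1 \<le> n \<Longrightarrow> 0 < \<delta> n"
    and D2: "(\<lambda>x. \<Sum>k | 1 \<le> k \<and> real (s k) \<le> x. \<Prod>i = 0..l - 1. inverse (\<delta> (k + i)))
               \<in> o[at_top](\<lambda>x. cnt x / ln (x / cnt x))"
  shows "(\<lambda>_. C :: real) \<in> o[at_top](\<lambda>x. cnt x / ln (x / cnt x))"
proof (rule landau_o.big_small_trans[OF _ D2])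
  let ?g = "\<lambda>k. \<Prod>i = 0..l - 1. inverse (\<delta> (k + i))"
  have g: "0 < ?g k" if "1 \<le> k" for k using pos that by (intro prod_pos) auto
  show "(\<lambda>_. C) \<in> O[at_top](\<lambda>x. \<Sum>k | 1 \<le> k \<and> real (s k) \<le> x. ?g k)"
  proof (rule bigoI)
    show "eventually (\<lambda>x. norm C \<le> (\<bar>C\<bar> / ?g 1) * norm (\<Sum>k | 1 \<le> k \<and> real (s k) \<le> x. ?g k)) at_top"
      using eventually_ge_at_top[of "real (s 1)"]
    proof eventually_elim
      case (elim x)
      have "?g 1 \<le> (\<Sum>k | 1 \<le> k \<and> real (s k) \<le> x. ?g k)"
        using elim finite_enumeration_le[OF s_mono, of x] g
        by (intro member_le_sum) (auto intro: less_imp_le)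
      then have "\<bar>C\<bar> * ?g 1 \<le> \<bar>C\<bar> * norm (\<Sum>k | 1 \<le> k \<and> real (s k) \<le> x. ?g k)"
        by (intro mult_left_mono) auto
      then show ?case using g[of 1] by (simp add: field_simps)
    qed
  qed
qed

end

lemma many_large_terms:
  fixes \<delta> :: "nat \<Rightarrow> real"
  assumes D1: "(\<lambda>x. real (card {n. 1 \<le> n \<and> real n \<le> x \<and> \<not> \<delta> n \<ge> 2})) \<in> o[at_top](\<lambda>x. x)"
  shows "eventually (\<lambda>N. 9 / 10 * real N - 3 \<le> real (card {i \<in> {2..<N}. 2 \<le> \<delta> i})) sequentially"
proof -
  have "eventually (\<lambda>x. norm (real (card {n. 1 \<le> n \<and> real n \<le> x \<and> \<not> \<delta> n \<ge> 2})) \<le> 1 / 10 * norm x) at_top"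
    by (rule landau_o.smallD[OF D1]) simp
  then have "eventually (\<lambda>N. norm (real (card {n. 1 \<le> n \<and> real n \<le> real N \<and> \<not> \<delta> n \<ge> 2}))
      \<le> 1 / 10 * norm (real N)) sequentially"
    by (rule eventually_compose_filterlim[OF _ filterlim_real_sequentially])
  then show ?thesis
  proof eventually_elim
    case (elim N)
    let ?B = "{n. 1 \<le> n \<and> real n \<le> real N \<and> \<not> \<delta> n \<ge> 2}"
    have "finite ?B" by (rule finite_subset[of _ "{..N}"]) auto
    then have "card {2..<N} \<le> card ({i \<in> {2..<N}. 2 \<le> \<delta> i} \<union> ?B)"
      by (intro card_mono) auto
    also have "\<dots> \<le> card {i \<in> {2..<N}. 2 \<le> \<delta> i} + card ?B" by (rule card_Un_le)
    finally have "N \<le> card {i \<in> {2..<N}. 2 \<le> \<delta> i} + card ?B + 2" by simp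
    then have "real N \<le> real (card {i \<in> {2..<N}. 2 \<le> \<delta> i}) + real (card ?B) + 2" by linarith
    moreover have "real (card ?B) \<le> real N / 10" using elim by simp
    ultimately show ?case by linarith
  qed
qed

lemma prod_inverse_le_half_power:
  fixes \<delta> :: "nat \<Rightarrow> real"
  assumes "finite I" "\<And>i. i \<in> I \<Longrightarrow> 1 \<le> \<delta> i"
  shows "(\<Prod>i\<in>I. inverse (\<delta> i)) \<le> (1 / 2) ^ card {i \<in> I. 2 \<le> \<delta> i}"
proof -
  have "(\<Prod>i\<in>I. inverse (\<delta> i)) \<le> (\<Prod>i\<in>I. if 2 \<le> \<delta> i then 1 / 2 else 1)"
  proof (rule prod_mono)
    fix i assume "i \<in> I"
    then show "0 \<le> inverse (\<delta> i) \<and> inverse (\<delta> i) \<le> (if 2 \<le> \<delta> i then 1 / 2 else 1)"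
      using assms(2)[of i] by (auto simp: field_simps)
  qed
  also have "\<dots> = (1 / 2) ^ card {i \<in> I. 2 \<le> \<delta> i}"
    using assms(1) by (simp add: prod.inter_filter[symmetric])
  finally show ?thesis .
qed

text \<open>The choice of \<open>y\<close> that balances the two factors of the count: with \<open>y = 1 / (40 * f)\<close> both
\<open>(1 + y) ^ n\<close> and \<open>1 / y ^ t\<close> are at most \<open>exp (Sx / 20)\<close>, the latter because \<open>t\<close> is small compared
with \<open>Sx / ln f\<close>. The square of their product, \<open>exp (Sx / 5)\<close>, is beaten by
\<open>(1 / 2) ^ g \<le> exp (2 - 9 / 20 * Sx)\<close>. Here \<open>Sx\<close> stands for the counting function at \<open>x\<close>, \<open>t\<close> for the
bound on the size of the truncated summands, and \<open>P\<close> for the probability of one prescribed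
truncation.\<close>

lemma union_bound_le_exp:
  fixes Sx f x y P :: real
  assumes x: "1 \<le> x" and Sx: "0 < Sx" and f: "f = x / Sx" "40 \<le> f"
    and t: "real t \<le> Sx / (40 * ln f)"
    and y: "y = 1 / (40 * f)"
    and n: "real n \<le> x + 1"
    and g: "9 / 10 * Sx - 3 \<le> real g"
    and P: "0 \<le> P" "P \<le> (1 / 2) ^ g"
  shows "2 ^ H * ((1 + y) ^ n / y ^ t)\<^sup>2 * P \<le> exp (real H + 2 - Sx / 4)"
proof -
  have y0: "0 < y" unfolding y using f(2) by simp
  have lnf: "0 < ln f" using f(2) by simp
  have "(1 + y) ^ n \<le> exp y ^ n" using y0 by (intro power_mono) auto
  also have "\<dots> = exp (real n * y)" by (simp add: exp_of_nat_mult)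
  also have "real n * y \<le> (2 * x) * y" using n x y0 by (intro mult_right_mono) auto
  also have "2 * x * y = Sx / 20" using x Sx unfolding y f(1) by (simp add: field_simps)
  finally have a: "(1 + y) ^ n \<le> exp (Sx / 20)" by simp
  have "1 / y ^ t = (40 * f) ^ t" by (simp add: y power_divide)
  also have "40 * f = exp (ln (40 * f))" using f(2) by simp
  also have "exp (ln (40 * f)) ^ t = exp (real t * ln (40 * f))" by (simp add: exp_of_nat_mult)
  also have "ln (40 * f) \<le> 2 * ln f" using f(2) by (simp add: ln_mult)
  then have "real t * ln (40 * f) \<le> (Sx / (40 * ln f)) * (2 * ln f)"
    using t lnf f(2) Sx by (intro mult_mono) auto
  also have "\<dots> = Sx / 20" using lnf by simp
  finally have b: "1 / y ^ t \<le> exp (Sx / 20)" by simp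
  have "(1 + y) ^ n / y ^ t = (1 + y) ^ n * (1 / y ^ t)" by simp
  also have "\<dots> \<le> exp (Sx / 20) * exp (Sx / 20)"
    using a b y0 by (intro mult_mono) auto
  finally have "((1 + y) ^ n / y ^ t)\<^sup>2 \<le> (exp (Sx / 20) * exp (Sx / 20))\<^sup>2"
    using y0 by (intro power_mono) auto
  also have "\<dots> = exp (Sx / 5)" by (simp add: power2_eq_square exp_add[symmetric])
  finally have c: "((1 + y) ^ n / y ^ t)\<^sup>2 \<le> exp (Sx / 5)" .
  have two: "(2::real) \<le> exp 1" using exp_ge_add_one_self[of 1] by simp
  have d: "2 ^ H \<le> exp (real H)"
    using power_mono[OF two, of H] by (simp add: exp_of_nat_mult[symmetric])
  have "(1 / 2 :: real) ^ g = exp (- (real g * ln 2))"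
    by (simp add: exp_minus exp_of_nat_mult power_divide inverse_eq_divide)
  also have "real g * (1 / 2) \<le> real g * ln 2"
    using ln2_ge_two_thirds by (intro mult_left_mono) auto
  then have "- (real g * ln 2) \<le> 2 - 9 / 20 * Sx" using g by linarith
  finally have e: "P \<le> exp (2 - 9 / 20 * Sx)" using P by simp
  have "2 ^ H * ((1 + y) ^ n / y ^ t)\<^sup>2 * P \<le> exp (real H) * exp (Sx / 5) * exp (2 - 9 / 20 * Sx)"
    using c d e P by (intro mult_mono) auto
  also have "\<dots> = exp (real H + 2 - Sx / 4)" by (simp add: exp_add[symmetric])
  finally show ?thesis .
qed

text \<open>Every large \<open>x\<close> makes the union bound small, with \<open>N\<close> the last index such that \<open>s N \<le> x\<close>. Then
\<open>N \<ge> S(x)\<close>; most of the factors \<open>inverse (\<delta> i)\<close> are at most \<open>1 / 2\<close>, and the negligibility of \<open>t\<close>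
makes the number of candidates \<open>exp\<close> of a small multiple of \<open>S(x)\<close>.\<close>

lemma (in sparse_sequence) exists_good_cutoff:
  fixes \<delta> :: "nat \<Rightarrow> real"
  assumes ge_1: "\<And>n. 2 \<le> n \<Longrightarrow> 1 \<le> \<delta> n"
    and many: "eventually (\<lambda>N. 9 / 10 * real N - 3 \<le> real (card {i \<in> {2..<N}. 2 \<le> \<delta> i})) sequentially"
    and t: "(\<lambda>x. real (t x)) \<in> o[at_top](\<lambda>x. cnt x / ln (x / cnt x))"
    and e: "0 < e"
  shows "\<exists>(x::nat) N y. s N \<le> x \<and> 0 < y \<and> y \<le> 1 \<and>
    2 ^ H * ((1 + y) ^ (x + 1) / y ^ t (real x))\<^sup>2 * (\<Prod>i\<in>{2..<N}. inverse (\<delta> i)) \<le> e"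
proof -
  from many obtain N0 where
    N0: "\<And>N. N0 \<le> N \<Longrightarrow> 9 / 10 * real N - 3 \<le> real (card {i \<in> {2..<N}. 2 \<le> \<delta> i})"
    unfolding eventually_sequentially by blast
  have "eventually (\<lambda>x. norm (real (t x)) \<le> 1 / 40 * norm (cnt x / ln (x / cnt x))) at_top"
    by (rule landau_o.smallD[OF t]) simp
  moreover note eventually_cnt_ge[of "max 1 (max (real N0) (4 * (real H + 2 - ln e)))"]
    eventually_ratio_ge[of 40] eventually_ge_at_top[of 1]
  ultimately have "eventually (\<lambda>x. norm (real (t x)) \<le> 1 / 40 * norm (cnt x / ln (x / cnt x)) \<and>
      max 1 (max (real N0) (4 * (real H + 2 - ln e))) \<le> cnt x \<and> 40 \<le> x / cnt x \<and> 1 \<le> x) at_top"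
    by eventually_elim blast
  then have "eventually (\<lambda>n. norm (real (t (real n))) \<le> 1 / 40 * norm (cnt (real n) / ln (real n / cnt (real n))) \<and>
      max 1 (max (real N0) (4 * (real H + 2 - ln e))) \<le> cnt (real n)
      \<and> 40 \<le> real n / cnt (real n) \<and> 1 \<le> real n) sequentially"
    by (rule eventually_compose_filterlim[OF _ filterlim_real_sequentially])
  then obtain x :: nat where x: "norm (real (t (real x))) \<le> 1 / 40 * norm (cnt (real x) / ln (real x / cnt (real x)))"
      "max 1 (max (real N0) (4 * (real H + 2 - ln e))) \<le> cnt (real x)"
      "40 \<le> real x / cnt (real x)" "1 \<le> real x"
    unfolding eventually_sequentially by blast
  define K where "K = {k. 1 \<le> k \<and> real (s k) \<le> real x}"
  have fin: "finite K" unfolding K_def by (rule finite_enumeration_le[OF s_mono])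
  have cntK: "cnt (real x) \<le> real (card K)" unfolding K_def by (rule counting_le_card_indices)
  then have ne: "K \<noteq> {}" using x(2) by auto
  define N where "N = Max K"
  have "N \<in> K" unfolding N_def using fin ne by (rule Max_in)
  then have sN: "s N \<le> x" by (simp add: K_def)
  have "K \<subseteq> {1..N}" using fin by (auto simp: N_def K_def)
  then have "card K \<le> N" using card_mono[of "{1..N}" K] by simp
  then have cntN: "cnt (real x) \<le> real N" using cntK by linarith
  have lnf: "0 < ln (real x / cnt (real x))" using x(3) by simp
  define f where "f = real x / cnt (real x)"
  define y where "y = 1 / (40 * f)"
  have f: "40 \<le> f" unfolding f_def by (rule x(3))
  have y: "0 < y" "y \<le> 1" using f by (auto simp: y_def field_simps)
  let ?g = "card {i \<in> {2..<N}. 2 \<le> \<delta> i}"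
  have "2 ^ H * ((1 + y) ^ (x + 1) / y ^ t (real x))\<^sup>2 * (\<Prod>i\<in>{2..<N}. inverse (\<delta> i))
      \<le> exp (real H + 2 - cnt (real x) / 4)"
  proof (rule union_bound_le_exp[where x = "real x" and f = f and g = ?g])
    show "1 \<le> real x" using x by simp
    show "0 < cnt (real x)" using x by simp
    show "f = real x / cnt (real x)" by (simp add: f_def)
    show "40 \<le> f" by (rule f)
    show "real (t (real x)) \<le> cnt (real x) / (40 * ln f)"
      using x(1,2) lnf by (simp add: f_def)
    show "y = 1 / (40 * f)" by (simp add: y_def)
    show "real (x + 1) \<le> real x + 1" by simp
    have "N0 \<le> N" using x(2) cntN by linarith
    then show "9 / 10 * cnt (real x) - 3 \<le> real ?g" using N0[of N] cntN by linarith
    show "0 \<le> (\<Prod>i\<in>{2..<N}. inverse (\<delta> i))"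
      using ge_1 by (intro prod_nonneg) (force simp: field_simps)
    show "(\<Prod>i\<in>{2..<N}. inverse (\<delta> i)) \<le> (1 / 2) ^ ?g"
      using ge_1 by (intro prod_inverse_le_half_power) auto
  qed
  also have "4 * (real H + 2 - ln e) \<le> cnt (real x)" using x(2) by simp
  then have "real H + 2 - cnt (real x) / 4 \<le> ln e" by (simp add: field_simps)
  then have "exp (real H + 2 - cnt (real x) / 4) \<le> exp (ln e)" by simp
  also have "\<dots> = e" using e by simp
  finally show ?thesis using sN y by blast
qed

section \<open>Excluding the two types of decomposition\<close>

context prob_space begin

text \<open>If one summand is finite, every large term has a neighbour within \<open>H\<close>. For a single index \<open>j\<close> with
\<open>\<delta> j\<close> huge this is already unlikely, and such indices exist beyond every bound.\<close>

lemma AE_no_finite_summand: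
  fixes s :: "nat \<Rightarrow> nat" and \<epsilon> :: "nat \<Rightarrow> 'a \<Rightarrow> int" and \<delta> :: "nat \<Rightarrow> real"
  assumes indep: "indep_vars (\<lambda>_. count_space UNIV) \<epsilon> {1..}"
    and inter: "AE \<omega> in M. interlaced s (\<lambda>n. int (s n) + \<epsilon> n \<omega>)"
    and p: "\<And>n k. 1 \<le> n \<Longrightarrow> prob {\<omega> \<in> space M. \<epsilon> n \<omega> = k} \<le> inverse (\<delta> n)"
    and unbounded: "\<And>J K. \<exists>j\<ge>J. K < \<delta> j"
  shows "AE \<omega> in M. \<not> (\<exists>A B. A \<subseteq> {0..int H} \<and> 2 \<le> card A \<and>
           (\<forall>z\<ge>int H. z \<in> (\<lambda>n. int (s n) + \<epsilon> n \<omega>) ` {1..} \<longleftrightarrow> z \<in> A + B))"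
proof (rule AE_not_if_covered_by_small_events)
  fix e :: real assume e: "0 < e"
  \<comment> \<open>\<open>c j > s (j - 1) \<ge> j - 2\<close>, so \<open>2 * H + 3 \<le> j\<close> makes the \<open>j\<close>-th term large enough\<close>
  obtain j where j: "2 * H + 3 \<le> j" "2 * real (2 * H + 1) / e < \<delta> j" using unbounded by blast
  have \<delta>j: "0 < \<delta> j" using j(2) e by (meson divide_nonneg_pos le_less_trans mult_nonneg_nonneg of_nat_0_le_iff zero_le_numeral)
  have meas: "random_variable (count_space UNIV) (\<epsilon> i)" if "1 \<le> i" for i
    using indep that by (auto simp: indep_vars_def)
  define near where "near i = {\<omega> \<in> space M. \<bar>\<epsilon> j \<omega> - \<epsilon> i \<omega> + (int (s j) - int (s i))\<bar> \<le> int H}" for i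
  have near_events: "near i \<in> events" if "1 \<le> i" for i
  proof -
    let ?W = "\<lambda>k. {z. \<bar>z - k + (int (s j) - int (s i))\<bar> \<le> int H}"
    have "(\<Union>k. (\<epsilon> i -` {k} \<inter> space M) \<inter> (\<epsilon> j -` ?W k \<inter> space M)) = near i"
      by (auto simp: near_def)
    moreover have "(\<epsilon> i -` {k} \<inter> space M) \<inter> (\<epsilon> j -` ?W k \<inter> space M) \<in> events" for k
      using that j by (intro sets.Int[OF measurable_sets[OF meas] measurable_sets[OF meas]]) auto
    then have "(\<Union>k. (\<epsilon> i -` {k} \<inter> space M) \<inter> (\<epsilon> j -` ?W k \<inter> space M)) \<in> events"
      by (intro sets.countable_UN image_subsetI)
    ultimately show ?thesis by simp
  qed
  have near_prob: "prob (near i) \<le> real (2 * H + 1) * inverse (\<delta> j)" if i: "1 \<le> i" "i \<noteq> j" for i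
    unfolding near_def
  proof (rule prob_close_pair_le[OF indep])
    let ?F = "{- int (s i)..int (s (Suc i))}"
    show "AE \<omega> in M. \<epsilon> i \<omega> \<in> ?F"
      using inter
    proof eventually_elim
      case (elim \<omega>)
      interpret interlaced s "\<lambda>n. int (s n) + \<epsilon> n \<omega>" by (rule elim)
      show ?case using c_nonneg[of i] c_less_s[of i] i by auto
    qed
  qed (use i j p in auto)
  let ?E = "near (j - 1) \<union> near (Suc j)"
  have "?E \<in> events" using j by (intro sets.Un near_events) auto
  moreover have "prob ?E \<le> e"
  proof -
    have "prob ?E \<le> prob (near (j - 1)) + prob (near (Suc j))"
      using j by (intro measure_Un_le near_events) auto
    also have "\<dots> \<le> real (2 * H + 1) * inverse (\<delta> j) + real (2 * H + 1) * inverse (\<delta> j)"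
      using j by (intro add_mono near_prob) auto
    also have "\<dots> = 2 * real (2 * H + 1) / \<delta> j" by (simp add: inverse_eq_divide)
    also have "2 * real (2 * H + 1) \<le> e * \<delta> j"
      using j(2) e by (simp add: pos_divide_less_eq mult.commute)
    then have "2 * real (2 * H + 1) / \<delta> j \<le> e"
      using \<delta>j by (simp add: pos_divide_le_eq)
    finally show ?thesis .
  qed
  moreover have "AE \<omega> in M. (\<exists>A B. A \<subseteq> {0..int H} \<and> 2 \<le> card A \<and>
           (\<forall>z\<ge>int H. z \<in> (\<lambda>n. int (s n) + \<epsilon> n \<omega>) ` {1..} \<longleftrightarrow> z \<in> A + B)) \<longrightarrow> \<omega> \<in> ?E"
    using inter AE_space
  proof eventually_elim
    case (elim \<omega>)
    interpret interlaced s "\<lambda>n. int (s n) + \<epsilon> n \<omega>" by (rule elim)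
    show ?case
    proof (rule impI, elim exE conjE)
      fix A B :: "int set"
      assume AB: "A \<subseteq> {0..int H}" "2 \<le> card A"
        "\<forall>z\<ge>int H. z \<in> (\<lambda>n. int (s n) + \<epsilon> n \<omega>) ` {1..} \<longleftrightarrow> z \<in> A + B"
      have "int (s (j - 1)) < int (s j) + \<epsilon> j \<omega>" using s_less_c[of "j - 1"] j by simp
      then have large: "2 * int H \<le> int (s j) + \<epsilon> j \<omega>"
        using enumeration_ge[OF s_mono, of "j - 1"] j(1) by linarith
      have "\<bar>(int (s j) + \<epsilon> j \<omega>) - (int (s (j - 1)) + \<epsilon> (j - 1) \<omega>)\<bar> \<le> int H
          \<or> \<bar>(int (s j) + \<epsilon> j \<omega>) - (int (s (Suc j)) + \<epsilon> (Suc j) \<omega>)\<bar> \<le> int H"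
      proof (rule finite_summand_gives_close_pair[OF AB(1,2) _ _ large])
        show "z \<in> (\<lambda>n. int (s n) + \<epsilon> n \<omega>) ` {1..} \<longleftrightarrow> z \<in> A + B" if "int H \<le> z" for z
          using AB(3) that by blast
        show "2 \<le> j" using j by simp
      qed
      moreover have "\<epsilon> j \<omega> - \<epsilon> i \<omega> + (int (s j) - int (s i))
          = (int (s j) + \<epsilon> j \<omega>) - (int (s i) + \<epsilon> i \<omega>)" for i by simp
      ultimately show "\<omega> \<in> ?E"
        using elim(2) unfolding near_def by (simp only: Un_iff mem_Collect_eq) blast
    qed
  qed
  ultimately show "\<exists>E\<in>events. prob E \<le> e \<and> (AE \<omega> in M. (\<exists>A B. A \<subseteq> {0..int H} \<and> 2 \<le> card A \<and>
           (\<forall>z\<ge>int H. z \<in> (\<lambda>n. int (s n) + \<epsilon> n \<omega>) ` {1..} \<longleftrightarrow> z \<in> A + B)) \<longrightarrow> \<omega> \<in> E)"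
    by blast
qed

text \<open>Four small elements in each summand make both summands sparse, with the same explicit bound on their
truncations, so the union bound applies.\<close>

lemma AE_no_infinite_summands:
  fixes s :: "nat \<Rightarrow> nat" and \<epsilon> :: "nat \<Rightarrow> 'a \<Rightarrow> int" and \<delta> :: "nat \<Rightarrow> real"
  assumes indep: "indep_vars (\<lambda>_. count_space UNIV) \<epsilon> {1..}"
    and inter: "AE \<omega> in M. interlaced s (\<lambda>n. int (s n) + \<epsilon> n \<omega>)"
    and p: "\<And>n k. 1 \<le> n \<Longrightarrow> prob {\<omega> \<in> space M. \<epsilon> n \<omega> = k} \<le> inverse (\<delta> n)"
    and cutoff: "\<And>e. 0 < e \<Longrightarrow> \<exists>(x::nat) N y. s N \<le> x \<and> 0 < y \<and> y \<le> 1 \<and>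
      2 ^ H * ((1 + y) ^ (x + 1) / y ^ (card {k. 1 \<le> k \<and> real (s k) \<le> real x \<and> s (k + 2) - s k \<le> 2 * H} + 2 * H))\<^sup>2
        * (\<Prod>i\<in>{2..<N}. inverse (\<delta> i)) \<le> e"
  shows "AE \<omega> in M. \<not> (\<exists>A B. A \<subseteq> {0..} \<and> B \<subseteq> {0..} \<and>
           4 \<le> card (A \<inter> {0..<int H}) \<and> 4 \<le> card (B \<inter> {0..<int H}) \<and>
           (\<forall>z\<ge>int H. z \<in> (\<lambda>n. int (s n) + \<epsilon> n \<omega>) ` {1..} \<longleftrightarrow> z \<in> A + B))"
    (is "AE \<omega> in M. \<not> ?decomp \<omega>")
proof (rule AE_not_if_covered_by_small_events)
  fix e :: real assume "0 < e"
  then obtain x :: nat and N y where N: "s N \<le> x" and y: "0 < y" "y \<le> 1" and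
    small: "2 ^ H * ((1 + y) ^ (x + 1) / y ^ (card {k. 1 \<le> k \<and> real (s k) \<le> real x \<and> s (k + 2) - s k \<le> 2 * H} + 2 * H))\<^sup>2
        * (\<Prod>i\<in>{2..<N}. inverse (\<delta> i)) \<le> e"
    using cutoff by blast
  define t where "t = card {k. 1 \<le> k \<and> real (s k) \<le> real x \<and> s (k + 2) - s k \<le> 2 * H} + 2 * H"
  obtain E where E: "E \<in> events"
    "prob E \<le> 2 ^ H * ((1 + y) ^ (x + 1) / y ^ t)\<^sup>2 * (\<Prod>i\<in>{2..<N}. inverse (\<delta> i))"
    "AE \<omega> in M. (\<exists>A B. A \<subseteq> {0..} \<and> B \<subseteq> {0..} \<and>
        card (A \<inter> {0..int x}) \<le> t \<and> card (B \<inter> {0..int x}) \<le> t \<and>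
        (\<forall>z\<ge>int H. z \<in> (\<lambda>n. int (s n) + \<epsilon> n \<omega>) ` {1..} \<longleftrightarrow> z \<in> A + B)) \<longrightarrow> \<omega> \<in> E"
    using prob_sparse_sumset_le[OF indep inter p N y, where H = H and t = t] by blast
  from E(3) inter have "AE \<omega> in M. ?decomp \<omega> \<longrightarrow> \<omega> \<in> E"
  proof eventually_elim
    case (elim \<omega>)
    interpret interlaced s "\<lambda>n. int (s n) + \<epsilon> n \<omega>" by (rule elim)
    show ?case
    proof (rule impI, elim exE conjE)
      fix A B :: "int set"
      assume AB: "A \<subseteq> {0..}" "B \<subseteq> {0..}" "4 \<le> card (A \<inter> {0..<int H})" "4 \<le> card (B \<inter> {0..<int H})"
        "\<forall>z\<ge>int H. z \<in> (\<lambda>n. int (s n) + \<epsilon> n \<omega>) ` {1..} \<longleftrightarrow> z \<in> A + B"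
      have "card (B \<inter> {0..int x}) \<le> t"
        unfolding t_def by (rule other_summand_sparse[OF AB(3)]) (use AB(5) in blast)
      moreover have "card (A \<inter> {0..int x}) \<le> t"
        unfolding t_def
        by (rule other_summand_sparse[OF AB(4)]) (use AB(5) add.commute[of A B] in auto)
      ultimately show "\<omega> \<in> E" using elim(1) AB by blast
    qed
  qed
  then show "\<exists>E\<in>events. prob E \<le> e \<and> (AE \<omega> in M. ?decomp \<omega> \<longrightarrow> \<omega> \<in> E)"
    using E(1,2) small unfolding t_def by (meson order_trans)
qed

end

section \<open>Total primitivity\<close>

lemma Nats_int_eq: "(\<nat> :: int set) = {0..}"
proof
  show "(\<nat> :: int set) \<subseteq> {0..}" by (auto elim: Nats_cases)
  show "{0..} \<subseteq> (\<nat> :: int set)" by (auto simp: Nats_altdef1)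
qed

text \<open>Every decomposition is described by one natural number \<open>H\<close>, which bounds the finite exceptional set
together with either a whole finite summand or four elements of both infinite summands. As there
are only countably many \<open>H\<close>, it suffices to exclude each of them almost surely.\<close>

lemma asymp_decomposable_cases:
  assumes "asymp_decomposable C"
  obtains (finite_summand) H A B where "A \<subseteq> {0..int H}" "2 \<le> card A"
      "\<forall>z\<ge>int H. z \<in> C \<longleftrightarrow> z \<in> A + B"
    | (infinite_summands) H A B where "A \<subseteq> {0..}" "B \<subseteq> {0..}"
      "4 \<le> card (A \<inter> {0..<int H})" "4 \<le> card (B \<inter> {0..<int H})"
      "\<forall>z\<ge>int H. z \<in> C \<longleftrightarrow> z \<in> A + B"
proof -
  obtain A B where AB: "A \<subseteq> {0..}" "B \<subseteq> {0..}" "infinite A \<or> 2 \<le> card A" "infinite B \<or> 2 \<le> card B"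
    "finite (sym_diff C (A + B))"
    using assms unfolding asymp_decomposable_def asymp_eq_set_def Nats_int_eq by blast
  have bounded: "\<exists>H. \<forall>z\<in>D. z < int H" if D: "finite D" for D :: "int set"
  proof -
    obtain m where m: "\<forall>z\<in>D. z \<le> m" using D bdd_above_finite[OF D] unfolding bdd_above_def by blast
    have "\<forall>z\<in>D. z < int (Suc (nat m))" using m by force
    then show ?thesis by blast
  qed
  obtain h where h: "\<forall>z\<in>sym_diff C (A + B). z < int h" using bounded AB(5) by blast
  then have agree: "\<forall>z\<ge>int h. z \<in> C \<longleftrightarrow> z \<in> A + B"
  proof (intro allI impI)
    fix z assume "int h \<le> z"
    then have "z \<notin> sym_diff C (A + B)" using h not_less by blast
    then show "z \<in> C \<longleftrightarrow> z \<in> A + B" by blast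
  qed
  have fin: thesis
    if A': "finite A'" "A' \<subseteq> {0..}" "2 \<le> card A'" "A' + B' = A + B" for A' B' :: "int set"
  proof -
    obtain k where k: "\<forall>z\<in>A'. z < int k" using bounded[OF A'(1)] by blast
    show thesis
    proof (rule finite_summand[of A' "h + k" B'])
      show "A' \<subseteq> {0..int (h + k)}"
      proof
        fix z assume "z \<in> A'"
        then have "0 \<le> z" "z < int k" using A'(2) k by auto
        then show "z \<in> {0..int (h + k)}" by simp
      qed
      show "\<forall>z\<ge>int (h + k). z \<in> C \<longleftrightarrow> z \<in> A' + B'" unfolding A'(4) using agree by simp
    qed (rule A'(3))
  qed
  have four: "\<exists>k. \<forall>H\<ge>k. 4 \<le> card (A' \<inter> {0..<int H})" if A': "infinite A'" "A' \<subseteq> {0..}" for A' :: "int set"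
  proof -
    obtain T where T: "T \<subseteq> A'" "finite T" "card T = 4"
      using infinite_arbitrarily_large[OF A'(1), of 4] by blast
    obtain k where k: "\<forall>z\<in>T. z < int k" using bounded[OF T(2)] by blast
    have "4 \<le> card (A' \<inter> {0..<int H})" if "k \<le> H" for H
    proof -
      have "T \<subseteq> A' \<inter> {0..<int H}"
      proof
        fix z assume z: "z \<in> T"
        then have "z \<in> A'" "z < int k" using T(1) k by auto
        moreover from this have "0 \<le> z" using A'(2) by auto
        ultimately show "z \<in> A' \<inter> {0..<int H}" using that by simp
      qed
      then show ?thesis using card_mono[of "A' \<inter> {0..<int H}" T] T by simp
    qed
    then show ?thesis by blast
  qed
  consider "finite A" | "finite B" | "infinite A" "infinite B" by blast
  then show thesis
  proof cases
    case 1
    then show thesis using AB(1,3) by (intro fin[of A B]) auto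
  next
    case 2
    then show thesis using AB(2,4) by (intro fin[of B A] add.commute) auto
  next
    case 3
    obtain k l where k: "\<forall>H\<ge>k. 4 \<le> card (A \<inter> {0..<int H})" and l: "\<forall>H\<ge>l. 4 \<le> card (B \<inter> {0..<int H})"
      using four[OF 3(1) AB(1)] four[OF 3(2) AB(2)] by blast
    show thesis
    proof (rule infinite_summands[of A B "h + k + l"])
      show "\<forall>z\<ge>int (h + k + l). z \<in> C \<longleftrightarrow> z \<in> A + B" using agree by auto
      show "4 \<le> card (A \<inter> {0..<int (h + k + l)})" using k by (simp del: of_nat_add)
      show "4 \<le> card (B \<inter> {0..<int (h + k + l)})" using l by (simp del: of_nat_add)
    qed (rule AB)+
  qed
qed

theorem theorem3:
  fixes S :: "nat set" and s :: "nat \<Rightarrow> nat" and f :: "real \<Rightarrow> real"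
    and \<delta> :: "nat \<Rightarrow> real" and M :: "'a measure" and \<epsilon> :: "nat \<Rightarrow> 'a \<Rightarrow> int"
  assumes S_inf: "infinite S"
    and s_enum: "strict_mono_on {1..} s" "S = s ` {1..}"
    and f_eq: "\<And>x. f x = x / counting S x"
    and S1: "filterlim f at_top at_top"
    and S2: "\<And>h::nat. (\<lambda>x. real (card {k. 1 \<le> k \<and> real (s k) \<le> x \<and> s (k + 2) - s k \<le> h}))
               \<in> o[at_top](\<lambda>x. counting S x / ln (f x))"
    and \<delta>_pos: "\<And>n. n \<ge> 1 \<Longrightarrow> \<delta> n > 0"
    and D1: "(\<lambda>x. real (card {n. 1 \<le> n \<and> real n \<le> x \<and> \<not> \<delta> n \<ge> 2})) \<in> o[at_top](\<lambda>x. x)"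
    and D2: "\<exists>l::nat. l \<ge> 1 \<and>
               (\<lambda>x. \<Sum>k | 1 \<le> k \<and> real (s k) \<le> x. \<Prod>i = 0..l - 1. inverse (\<delta> (k + i)))
                 \<in> o[at_top](\<lambda>x. counting S x / ln (f x))"
    and D3: "\<And>n. n \<ge> 2 \<Longrightarrow> 1 \<le> \<delta> n \<and> \<delta> n \<le> (real (s (n + 1)) - real (s (n - 1))) / 2"
    and M: "prob_space M"
    and indep: "prob_space.indep_vars M (\<lambda>_. count_space UNIV) \<epsilon> {1..}"
    and E1: "\<And>n. n \<ge> 2 \<Longrightarrow> AE \<omega> in M.
               - ((real (s n) - real (s (n - 1))) / 2) < real_of_int (\<epsilon> n \<omega>) \<and>
               real_of_int (\<epsilon> n \<omega>) \<le> (real (s (n + 1)) - real (s n)) / 2"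
    and E1_first: "AE \<omega> in M. - real (s 1) \<le> real_of_int (\<epsilon> 1 \<omega>) \<and>
               real_of_int (\<epsilon> 1 \<omega>) \<le> (real (s 2) - real (s 1)) / 2"
    and E2: "\<And>n k. n \<ge> 1 \<Longrightarrow> measure M {\<omega> \<in> space M. \<epsilon> n \<omega> = k} \<le> inverse (\<delta> n)"
  shows "AE \<omega> in M. totally_primitive {int (s n) + \<epsilon> n \<omega> | n. n \<ge> 1}"
proof -
  interpret prob_space M by (rule M)
  have counting: "f = (\<lambda>x. x / counting (s ` {1..}) x)" using f_eq s_enum(2) by auto
  interpret sparse_sequence s
    using s_enum(1) S1 unfolding counting by unfold_locales
  obtain l :: nat where
    D2': "(\<lambda>x. \<Sum>k | 1 \<le> k \<and> real (s k) \<le> x. \<Prod>i = 0..l - 1. inverse (\<delta> (k + i)))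
            \<in> o[at_top](\<lambda>x. cnt x / ln (x / cnt x))"
    using D2 unfolding counting s_enum(2) by blast
  have inter: "AE \<omega> in M. interlaced s (\<lambda>n. int (s n) + \<epsilon> n \<omega>)"
  proof -
    have "AE \<omega> in M. \<forall>n\<ge>2. - ((real (s n) - real (s (n - 1))) / 2) < real_of_int (\<epsilon> n \<omega>) \<and>
               real_of_int (\<epsilon> n \<omega>) \<le> (real (s (n + 1)) - real (s n)) / 2"
      unfolding AE_all_countable using E1 by simp
    then show ?thesis using E1_first
    proof eventually_elim
      case (elim \<omega>)
      show ?case
      proof
        show "strict_mono_on {1..} s" by (rule s_enum)
        show "0 \<le> int (s 1) + \<epsilon> 1 \<omega>" using elim(2) by linarith
        fix n :: nat assume n: "1 \<le> n"
        have "- ((real (s (Suc n)) - real (s n)) / 2) < real_of_int (\<epsilon> (Suc n) \<omega>)"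
          using elim(1)[rule_format, of "Suc n"] n by simp
        then have "real_of_int (int (s n) + int (s (Suc n)))
            < real_of_int (2 * (int (s (Suc n)) + \<epsilon> (Suc n) \<omega>))"
          by (simp add: field_simps)
        then show "int (s n) + int (s (Suc n)) < 2 * (int (s (Suc n)) + \<epsilon> (Suc n) \<omega>)"
          by (simp only: of_int_less_iff)
        have "real_of_int (\<epsilon> n \<omega>) \<le> (real (s (Suc n)) - real (s n)) / 2"
        proof (cases "n = 1")
          case True
          then show ?thesis using elim(2) by (simp add: numeral_2_eq_2)
        next
          case False
          then show ?thesis using elim(1)[rule_format, of n] n by simp
        qed
        then have "real_of_int (2 * (int (s n) + \<epsilon> n \<omega>))
            \<le> real_of_int (int (s n) + int (s (Suc n)))"
          by (simp add: field_simps)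
        then show "2 * (int (s n) + \<epsilon> n \<omega>) \<le> int (s n) + int (s (Suc n))"
          by (simp only: of_int_le_iff)
      qed
    qed
  qed
  have unbounded: "\<exists>j\<ge>J. K < \<delta> j" for J K
    by (rule unbounded_if_products_negligible[OF \<delta>_pos D2'])
  have "AE \<omega> in M. \<forall>H. \<not> (\<exists>A B. A \<subseteq> {0..int H} \<and> 2 \<le> card A \<and>
           (\<forall>z\<ge>int H. z \<in> (\<lambda>n. int (s n) + \<epsilon> n \<omega>) ` {1..} \<longleftrightarrow> z \<in> A + B))"
    unfolding AE_all_countable
    using AE_no_finite_summand[OF indep inter E2 unbounded] by blast
  moreover have "AE \<omega> in M. \<forall>H. \<not> (\<exists>A B. A \<subseteq> {0..} \<and> B \<subseteq> {0..} \<and>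
           4 \<le> card (A \<inter> {0..<int H}) \<and> 4 \<le> card (B \<inter> {0..<int H}) \<and>
           (\<forall>z\<ge>int H. z \<in> (\<lambda>n. int (s n) + \<epsilon> n \<omega>) ` {1..} \<longleftrightarrow> z \<in> A + B))"
    unfolding AE_all_countable
  proof
    fix H
    let ?t = "\<lambda>x. card {k. 1 \<le> k \<and> real (s k) \<le> x \<and> s (k + 2) - s k \<le> 2 * H} + 2 * H"
    have "(\<lambda>x. real (?t x)) \<in> o[at_top](\<lambda>x. cnt x / ln (x / cnt x))"
      unfolding of_nat_add
    proof (rule sum_in_smallo)
      show "(\<lambda>x. real (card {k. 1 \<le> k \<and> real (s k) \<le> x \<and> s (k + 2) - s k \<le> 2 * H}))
          \<in> o[at_top](\<lambda>x. cnt x / ln (x / cnt x))"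
        using S2[of "2 * H"] unfolding counting s_enum(2) .
    qed (rule constants_negligible[OF \<delta>_pos D2'])
    moreover have "1 \<le> \<delta> n" if "2 \<le> n" for n using D3 that by blast
    ultimately show "AE \<omega> in M. \<not> (\<exists>A B. A \<subseteq> {0..} \<and> B \<subseteq> {0..} \<and>
           4 \<le> card (A \<inter> {0..<int H}) \<and> 4 \<le> card (B \<inter> {0..<int H}) \<and>
           (\<forall>z\<ge>int H. z \<in> (\<lambda>n. int (s n) + \<epsilon> n \<omega>) ` {1..} \<longleftrightarrow> z \<in> A + B))"
      by (intro AE_no_infinite_summands[OF indep inter E2] exists_good_cutoff[where t = ?t]
            many_large_terms[OF D1])
  qed
  ultimately show ?thesis using inter
  proof eventually_elim
    case (elim \<omega>)
    interpret interlaced s "\<lambda>n. int (s n) + \<epsilon> n \<omega>" by (rule elim)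
    let ?C = "(\<lambda>n. int (s n) + \<epsilon> n \<omega>) ` {1..}"
    have "{int (s n) + \<epsilon> n \<omega> | n. n \<ge> 1} = ?C" by auto
    moreover have "?C \<subseteq> \<nat>" unfolding Nats_int_eq using c_nonneg by auto
    moreover have "\<not> asymp_decomposable ?C"
    proof
      assume "asymp_decomposable ?C"
      then show False
        by (cases rule: asymp_decomposable_cases) (use elim(1,2) in blast)+
    qed
    ultimately show ?case unfolding totally_primitive_def by simp
  qed
qed

end
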